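(* Let $s\ge 2$, $h>0$, and let $f:\mathbb{R}^{\ge0}\to\mathbb{R}^{\ge0}$ be non-increasing with $f(y)<1/s$ for all $y\ge0$. Let positions $X_i(n)\in\mathbb{R}^3$ and velocities $V_i(n)\in\mathbb{R}^3$, $1\le i\le s$, $n\ge0$, satisfy $$X_i(n+1)=X_i(n)+hV_i(n),\qquad V_i(n+1)=V_i(n)+\sum_{j\ne i}f(\|X_i(n)-X_j(n)\|)\,(V_j(n)-V_i(n)).$$ Set $M_x=\max_{1\le i<j\le s}\|X_i(0)-X_j(0)\|$ and $M_v=\max_{1\le i<j\le s}\|V_i(0)-V_j(0)\|$, and assume $$M_v<\frac{s}{3h}\int_{M_x}^{\infty}f(y)\,dy .$$ Then all the velocities $V_i(n)$ converge, as $n\to\infty$, to a common value. Moreover, there exists $R\ge0$ such that $\|X_i(n)-X_j(n)\|\le R$ for all $1\le i,j\le s$ and all $n\ge0$.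
   Context: $\|\cdot\|$ is the Euclidean norm on $\mathbb{R}^3$. The integral is allowed to be $+\infty$, in which case the assumption on $M_v$ holds automatically. *)

theory Defs
  imports "HOL-Analysis.Analysis"
begin

(* The particles are indexed by {1..s}; the set below is finite, and it is nonempty
   exactly when s >= 2. *)
definition max_distance :: "nat \<Rightarrow> (nat \<Rightarrow> real ^ 3) \<Rightarrow> real" where
  "max_distance s Z = Max {norm (Z i - Z j) | i j. 1 \<le> i \<and> i < j \<and> j \<le> s}"

end

theory Submission
  imports Defs
begin

text \<open>
  Write \<open>D n\<close> and \<open>E n\<close> for the diameters of the positions and of the velocities. A velocity update
  is an averaging by a row-stochastic matrix all of whose entries are at least \<open>f (D n)\<close> (the
  bound \<open>f < 1 / s\<close> takes care of the diagonal), so \<open>E (n + 1) \<le> (1 - s * f (D n)) * E n\<close>, while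
  \<open>D (n + 1) \<le> D n + h * E n\<close>. As \<open>f\<close> is non-increasing, \<open>E n + (s / h) * (\<integral>y = 0..D n. f y)\<close> is
  then non-increasing in \<open>n\<close>, and the hypothesis on \<open>M\<^sub>v\<close> confines \<open>D\<close> to some \<open>[0, R]\<close> with
  \<open>f R > 0\<close>. Hence \<open>E\<close> decays geometrically, and since the weights are symmetric the mean velocity
  is conserved and is the common limit.
\<close>

section \<open>Integrals of non-increasing functions\<close>

lemma integrable_on_antimono_on:
  fixes f :: "real \<Rightarrow> real"
  assumes "antimono_on {a..b} f"
  shows "f integrable_on {a..b}"
proof -
  have "mono_on {a..b} (\<lambda>x. - f x)"
    using assms by (auto simp: monotone_on_def)
  from integrable_neg[OF integrable_on_mono_on[OF this]] show ?thesis
    by simp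
qed

text \<open>The primitive of a non-increasing function is concave with \<open>f x\<close> as a
  supergradient at \<open>x\<close>. The order of \<open>x\<close> and \<open>y\<close> is left open
  because the position diameter may shrink as well as grow.\<close>

lemma integral_diff_le_antimono:
  fixes f :: "real \<Rightarrow> real"
  assumes anti: "antimono_on {a..} f" and xy: "x \<ge> a" "y \<ge> a"
  shows "integral {a..y} f - integral {a..x} f \<le> f x * (y - x)"
proof -
  have int: "f integrable_on {u..v}" if "u \<ge> a" for u v
    by (rule integrable_on_antimono_on, rule monotone_on_subset[OF anti]) (use that in auto)
  show ?thesis
  proof (cases "x \<le> y")
    case True
    have "integral {a..y} f - integral {a..x} f = integral {x..y} f"
      using Henstock_Kurzweil_Integration.integral_combine[OF xy(1) True int[of a y]] by simp
    also have "\<dots> \<le> integral {x..y} (\<lambda>_. f x)"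
      by (rule integral_le[OF int]) (use xy anti in \<open>auto simp: monotone_on_def\<close>)
    finally show ?thesis
      using True by (simp add: mult.commute)
  next
    case False
    then have yx: "y \<le> x" by simp
    have "f x * (x - y) = integral {y..x} (\<lambda>_. f x)"
      using yx by (simp add: mult.commute)
    also have "\<dots> \<le> integral {y..x} f"
      by (rule integral_le[OF _ int]) (use xy anti in \<open>auto simp: monotone_on_def\<close>)
    also have "\<dots> = integral {a..x} f - integral {a..y} f"
      using Henstock_Kurzweil_Integration.integral_combine[OF xy(2) yx int[of a x]] by simp
    finally show ?thesis
      by (simp add: algebra_simps)
  qed
qed

text \<open>Continuity from below of the measure with density \<open>f\<close>, along the intervals
  \<open>{a..a + real n}\<close>, brings the bound down to a bounded interval, where the Lebesgue
  and gauge integrals agree. An infinite integral is covered too.\<close>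

lemma ex_integral_gt:
  fixes f :: "real \<Rightarrow> real"
  assumes anti: "antimono_on {a..} f" and nonneg: "\<And>y. y \<ge> a \<Longrightarrow> f y \<ge> 0"
    and c: "c \<ge> 0" and lt: "ennreal c < (\<integral>\<^sup>+y\<in>{a..}. ennreal (f y) \<partial>lborel)"
  shows "\<exists>r\<ge>a. c < integral {a..r} f"
proof -
  \<comment> \<open>Nothing is known about \<open>f\<close> to the left of \<open>a\<close>.
    Continuing it there by the constant \<open>f a\<close> gives a function monotone on the whole
    line, hence Borel.\<close>
  define g where "g y = f (max a y)" for y
  have "mono (\<lambda>y. - g y)"
    using anti by (auto simp: mono_def monotone_on_def g_def)
  from borel_measurable_uminus[OF borel_measurable_mono[OF this]]
  have g_meas [measurable]: "g \<in> borel_measurable borel" by simp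
  have int: "f integrable_on {a..r}" for r
    by (rule integrable_on_antimono_on, rule monotone_on_subset[OF anti]) auto
  let ?M = "density lborel (\<lambda>y. ennreal (g y))"
  have em: "emeasure ?M A = (\<integral>\<^sup>+y\<in>A. ennreal (f y) \<partial>lborel)" if "A \<subseteq> {a..}" "A \<in> sets borel" for A
    using that by (simp add: emeasure_density)
      (auto intro!: nn_integral_cong simp: g_def max_def split: split_indicator)
  have un: "(\<Union>n. {a..a + real n}) = {a..}"
  proof (intro equalityI subsetI)
    fix x assume "x \<in> {a..}"
    moreover obtain n where "x - a \<le> real n" using real_arch_simple by blast
    ultimately show "x \<in> (\<Union>n. {a..a + real n})" by (auto simp: algebra_simps intro!: exI[of _ n])
  qed auto
  have "(SUP n. emeasure ?M {a..a + real n}) = emeasure ?M (\<Union>n. {a..a + real n})"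
    by (rule SUP_emeasure_incseq) (auto simp: incseq_def)
  then have "ennreal c < (SUP n. emeasure ?M {a..a + real n})"
    using lt by (simp add: un em)
  then obtain n where "ennreal c < emeasure ?M {a..a + real n}"
    by (auto simp: less_SUP_iff)
  also have "\<dots> = ennreal (integral {a..a + real n} f)"
    using nonneg by (subst em) (auto intro!: nn_integral_has_integral_lebesgue' integrable_integral int)
  finally show ?thesis
    using c by (intro exI[of _ "a + real n"]) (auto simp: ennreal_less_iff)
qed

lemma ex_integral_gt_pos:
  fixes f :: "real \<Rightarrow> real"
  assumes anti: "antimono_on {a..} f" and nonneg: "\<And>y. y \<ge> a \<Longrightarrow> f y \<ge> 0"
    and c: "c \<ge> 0" and lt: "ennreal c < (\<integral>\<^sup>+y\<in>{a..}. ennreal (f y) \<partial>lborel)"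
  shows "\<exists>r\<ge>a. c < integral {a..r} f \<and> f r > 0"
proof -
  obtain t where t: "t \<ge> a" "c < integral {a..t} f"
    using ex_integral_gt[OF assms] by blast
  \<comment> \<open>Halfway between \<open>c\<close> and the integral up to \<open>t\<close>: above
    \<open>c\<close>, yet with mass left over between \<open>r\<close> and \<open>t\<close>.\<close>
  let ?m = "(c + integral {a..t} f) / 2"
  have "f integrable_on {a..t}"
    by (rule integrable_on_antimono_on, rule monotone_on_subset[OF anti]) auto
  from indefinite_integral_continuous_1[OF this] t c
  obtain r where r: "a \<le> r" "r \<le> t" "integral {a..r} f = ?m"
    using IVT'[of "\<lambda>x. integral {a..x} f" a ?m t] by auto
  \<comment> \<open>The integral still grows strictly beyond \<open>r\<close>, which forces \<open>f r > 0\<close>.\<close>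
  have "0 < integral {a..t} f - integral {a..r} f"
    using t r by simp
  also have "\<dots> \<le> f r * (t - r)"
    by (rule integral_diff_le_antimono[OF anti]) (use r t in auto)
  finally have "f r > 0"
    using r nonneg[of r] by (cases "f r = 0") auto
  with r t show ?thesis by auto
qed

section \<open>The coupled recursive inequalities for the diameters\<close>

text \<open>A Lyapunov argument: the primitive of \<open>f\<close> along \<open>d n\<close> never
  reaches its value at \<open>r\<close>, so \<open>d n\<close> cannot pass \<open>r\<close>. The
  extra \<open>f r > 0\<close> later yields a contraction factor below 1.\<close>

lemma bounded_of_coupled_recurrence:
  fixes f :: "real \<Rightarrow> real" and d e :: "nat \<Rightarrow> real"
  assumes anti: "antimono_on {0..} f" and nonneg: "\<And>y. y \<ge> 0 \<Longrightarrow> f y \<ge> 0"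
    and h: "h > 0" and \<sigma>: "\<sigma> > 0"
    and d0: "\<And>n. d n \<ge> 0" and e0: "\<And>n. e n \<ge> 0"
    and d: "\<And>n. d (Suc n) \<le> d n + h * e n"
    and e: "\<And>n. e (Suc n) \<le> (1 - \<sigma> * f (d n)) * e n"
    and lt: "ennreal (e 0) < ennreal (\<sigma> / h) * (\<integral>\<^sup>+y\<in>{d 0..}. ennreal (f y) \<partial>lborel)"
  shows "\<exists>r\<ge>0. f r > 0 \<and> (\<forall>n. d n \<le> r)"
proof -
  define F where "F y = integral {0..y} f" for y
  have F: "F y - F x \<le> f x * (y - x)" if "x \<ge> 0" "y \<ge> 0" for x y
    unfolding F_def by (rule integral_diff_le_antimono[OF anti that])
  have F_mono: "F x \<le> F y" if "0 \<le> x" "x \<le> y" for x y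
  proof -
    have "F x - F y \<le> f y * (x - y)" using that by (intro F) auto
    also have "\<dots> \<le> 0" using that nonneg[of y] by (simp add: mult_nonneg_nonpos)
    finally show ?thesis by simp
  qed
  let ?c = "h / \<sigma> * e 0"
  have anti0: "antimono_on {d 0..} f"
    by (rule monotone_on_subset[OF anti]) (use d0[of 0] in auto)
  have "ennreal ?c = ennreal (h / \<sigma>) * ennreal (e 0)"
    using h \<sigma> e0 by (subst ennreal_mult[symmetric]) auto
  also have "\<dots> < ennreal (h / \<sigma>) * (ennreal (\<sigma> / h) * (\<integral>\<^sup>+y\<in>{d 0..}. ennreal (f y) \<partial>lborel))"
    by (rule ennreal_mult_strict_left_mono[OF lt]) (use h \<sigma> in auto)
  also have "\<dots> = (\<integral>\<^sup>+y\<in>{d 0..}. ennreal (f y) \<partial>lborel)"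
    using h \<sigma> by (simp add: mult.assoc[symmetric] ennreal_mult[symmetric])
  finally have "\<exists>r\<ge>d 0. ?c < integral {d 0..r} f \<and> f r > 0"
    using h \<sigma> e0 d0 nonneg order_trans[OF d0[of 0]] by (intro ex_integral_gt_pos[OF anti0]) auto
  then obtain r where r: "r \<ge> d 0" "?c < integral {d 0..r} f" "f r > 0"
    by blast
  have "f integrable_on {0..r}"
    by (rule integrable_on_antimono_on, rule monotone_on_subset[OF anti]) auto
  then have Fr: "?c < F r - F (d 0)"
    using Henstock_Kurzweil_Integration.integral_combine[OF d0 r(1)] r(2)
    unfolding F_def by (metis add_diff_cancel_left')
  \<comment> \<open>The weight \<open>h / \<sigma>\<close> is chosen so that the loss of the
    velocity term, \<open>h * f (d n) * e n\<close>, pays exactly for the largest possible gain of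
    \<open>F\<close>.\<close>
  have lyap: "h / \<sigma> * e n + F (d n) \<le> ?c + F (d 0)" for n
  proof (induction n)
    case (Suc n)
    have "F (d (Suc n)) - F (d n) \<le> f (d n) * (d (Suc n) - d n)"
      by (rule F[OF d0 d0])
    also have "\<dots> \<le> f (d n) * (h * e n)"
      using d[of n] nonneg[OF d0] by (intro mult_left_mono) auto
    finally have "F (d (Suc n)) - F (d n) \<le> h * f (d n) * e n"
      by (simp add: mult_ac)
    moreover have "h / \<sigma> * e (Suc n) \<le> h / \<sigma> * ((1 - \<sigma> * f (d n)) * e n)"
      using e h \<sigma> by (intro mult_left_mono) auto
    moreover have "h / \<sigma> * ((1 - \<sigma> * f (d n)) * e n) = h / \<sigma> * e n - h * f (d n) * e n"
      using \<sigma> by (simp add: field_simps)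
    ultimately show ?case
      using Suc.IH by linarith
  qed simp
  have "d n \<le> r" for n
  proof (rule ccontr)
    assume "\<not> d n \<le> r"
    then have "F r \<le> F (d n)"
      using r d0[of 0] by (intro F_mono) auto
    moreover have "h / \<sigma> * e n \<ge> 0"
      using h \<sigma> e0 by simp
    ultimately show False
      using lyap[of n] Fr by linarith
  qed
  with r(3) order_trans[OF d0 r(1)] show ?thesis
    by (intro exI[of _ r]) auto
qed

section \<open>Averaging contracts the diameter\<close>

text \<open>A Dobrushin-type contraction: the mass \<phi> that both weightings put on every point
  cancels in the difference, and only the remaining mass is moved, over distances at most
  \<open>D\<close>.\<close>

lemma norm_weighted_sum_diff_le:
  fixes x :: "'i \<Rightarrow> 'a::real_normed_vector"
  assumes a1: "sum a I = 1" and b1: "sum b I = 1"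
    and a: "\<And>k. k \<in> I \<Longrightarrow> \<phi> \<le> a k" and b: "\<And>k. k \<in> I \<Longrightarrow> \<phi> \<le> b k"
    and D: "\<And>k l. k \<in> I \<Longrightarrow> l \<in> I \<Longrightarrow> norm (x k - x l) \<le> D"
    and \<phi>: "real (card I) * \<phi> < 1"
  shows "norm ((\<Sum>k\<in>I. a k *\<^sub>R x k) - (\<Sum>k\<in>I. b k *\<^sub>R x k)) \<le> (1 - real (card I) * \<phi>) * D"
proof -
  define m where "m = 1 - real (card I) * \<phi>"
  define p q where "p k = a k - \<phi>" and "q k = b k - \<phi>" for k
  have m: "m > 0" using \<phi> by (simp add: m_def)
  have p: "sum p I = m" and q: "sum q I = m"
    by (simp_all add: p_def q_def m_def sum_subtractf a1 b1)
  \<comment> \<open>Removing the common part \<open>\<phi>\<close> of the weights leaves a coupling of two measures of mass \<open>m\<close>.\<close>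
  have "m *\<^sub>R ((\<Sum>k\<in>I. a k *\<^sub>R x k) - (\<Sum>k\<in>I. b k *\<^sub>R x k))
      = sum q I *\<^sub>R (\<Sum>k\<in>I. p k *\<^sub>R x k) - sum p I *\<^sub>R (\<Sum>l\<in>I. q l *\<^sub>R x l)"
    unfolding p q by (simp add: p_def q_def scaleR_left_diff_distrib sum_subtractf
        scaleR_right_diff_distrib)
  also have "\<dots> = (\<Sum>k\<in>I. \<Sum>l\<in>I. (p k * q l) *\<^sub>R (x k - x l))"
  proof -
    have "sum q I *\<^sub>R (\<Sum>k\<in>I. p k *\<^sub>R x k) = (\<Sum>k\<in>I. \<Sum>l\<in>I. (p k * q l) *\<^sub>R x k)"
      by (simp add: scaleR_sum_right mult.commute flip: scaleR_sum_left sum_distrib_left)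
    moreover have "sum p I *\<^sub>R (\<Sum>l\<in>I. q l *\<^sub>R x l) = (\<Sum>k\<in>I. \<Sum>l\<in>I. (p k * q l) *\<^sub>R x l)"
      by (subst sum.swap) (simp add: scaleR_sum_right flip: scaleR_sum_left sum_distrib_right)
    ultimately show ?thesis
      by (simp add: scaleR_right_diff_distrib sum_subtractf)
  qed
  finally have eq: "m *\<^sub>R ((\<Sum>k\<in>I. a k *\<^sub>R x k) - (\<Sum>k\<in>I. b k *\<^sub>R x k))
      = (\<Sum>k\<in>I. \<Sum>l\<in>I. (p k * q l) *\<^sub>R (x k - x l))" .
  have "m * norm ((\<Sum>k\<in>I. a k *\<^sub>R x k) - (\<Sum>k\<in>I. b k *\<^sub>R x k))
      = norm (\<Sum>k\<in>I. \<Sum>l\<in>I. (p k * q l) *\<^sub>R (x k - x l))"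
    unfolding eq[symmetric] using m by simp
  also have "\<dots> \<le> (\<Sum>k\<in>I. \<Sum>l\<in>I. p k * q l * D)"
    by (intro sum_norm_le)
      (use a b D in \<open>auto simp: p_def q_def abs_mult intro!: mult_left_mono\<close>)
  also have "\<dots> = m * (m * D)"
    by (simp add: sum_distrib_left[symmetric] sum_distrib_right[symmetric] p q mult.assoc)
  finally show ?thesis
    using m by (simp add: m_def)
qed

lemma norm_consensus_step_diff_le:
  fixes v :: "'i \<Rightarrow> 'a::real_normed_vector"
  assumes fin: "finite I" and ij: "i \<in> I" "j \<in> I"
    and lo: "\<And>k l. k \<in> I \<Longrightarrow> l \<in> I \<Longrightarrow> \<phi> \<le> w k l"
    and hi: "\<And>k l. k \<in> I \<Longrightarrow> l \<in> I \<Longrightarrow> w k l < 1 / real (card I)"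
    and D: "\<And>k l. k \<in> I \<Longrightarrow> l \<in> I \<Longrightarrow> norm (v k - v l) \<le> D"
  shows "norm ((v i + (\<Sum>k\<in>I - {i}. w i k *\<^sub>R (v k - v i))) -
           (v j + (\<Sum>k\<in>I - {j}. w j k *\<^sub>R (v k - v j)))) \<le> (1 - real (card I) * \<phi>) * D"
proof -
  \<comment> \<open>Row \<open>r\<close> of the stochastic matrix of the update. The diagonal entry
    takes up the remaining mass, which is at least \<open>1 / real (card I)\<close> since the other
    \<open>card I - 1\<close> entries are below that value.\<close>
  define a where "a r k = (if k = r then 1 - sum (w r) (I - {r}) else w r k)" for r k
  have card: "real (card I) > 0"
    using fin ij by (auto simp: card_gt_0_iff)
  have \<phi>: "\<phi> < 1 / real (card I)"
    using lo[OF ij] hi[OF ij] by linarith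
  have step: "v r + (\<Sum>k\<in>I - {r}. w r k *\<^sub>R (v k - v r)) = (\<Sum>k\<in>I. a r k *\<^sub>R v k)"
    and one: "sum (a r) I = 1" and low: "\<And>k. k \<in> I \<Longrightarrow> \<phi> \<le> a r k" if r: "r \<in> I" for r
  proof -
    have off: "(\<Sum>k\<in>I - {r}. a r k *\<^sub>R v k) = (\<Sum>k\<in>I - {r}. w r k *\<^sub>R v k)"
      "sum (a r) (I - {r}) = sum (w r) (I - {r})"
      by (auto intro!: sum.cong simp: a_def)
    show "sum (a r) I = 1"
      using fin r by (simp add: sum.remove[of I r] off) (simp add: a_def)
    show "v r + (\<Sum>k\<in>I - {r}. w r k *\<^sub>R (v k - v r)) = (\<Sum>k\<in>I. a r k *\<^sub>R v k)"
      using fin r by (simp add: sum.remove[of I r] off)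
        (simp add: a_def scaleR_right_diff_distrib scaleR_left_diff_distrib sum_subtractf
          scaleR_sum_left)
    have "sum (w r) (I - {r}) \<le> (\<Sum>k\<in>I - {r}. 1 / real (card I))"
      using hi r by (intro sum_mono less_imp_le) auto
    also have "\<dots> = 1 - 1 / real (card I)"
      using fin r card by (simp add: of_nat_diff Suc_le_eq card_gt_0_iff diff_divide_distrib)
    finally show "\<phi> \<le> a r k" if "k \<in> I" for k
      using \<phi> lo[OF r that] by (auto simp: a_def)
  qed
  show ?thesis
    unfolding step[OF ij(1)] step[OF ij(2)]
    by (rule norm_weighted_sum_diff_le) (use one low ij D \<phi> card in \<open>auto simp: field_simps\<close>)
qed

lemma sum_antisymmetric_eq_0:
  fixes g :: "'i \<Rightarrow> 'i \<Rightarrow> 'a::real_vector"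
  assumes fin: "finite I" and anti: "\<And>i j. g j i = - g i j"
  shows "(\<Sum>i\<in>I. \<Sum>j\<in>I - {i}. g i j) = 0"
proof -
  \<comment> \<open>With a vanishing diagonal the inner sum can run over all of \<open>I\<close>, so
    that exchanging the two sums turns the total into its own negative.\<close>
  have diag: "g i i = 0" for i
    using anti[of i i] by (simp add: eq_neg_iff_add_eq_0 flip: scaleR_2)
  have "(\<Sum>i\<in>I. \<Sum>j\<in>I - {i}. g i j) = (\<Sum>i\<in>I. \<Sum>j\<in>I. g i j)" (is "_ = ?S")
    using fin by (intro sum.cong refl sum.mono_neutral_left) (auto simp: diag)
  moreover have "?S = (\<Sum>i\<in>I. \<Sum>j\<in>I. - g i j)"
    by (subst sum.swap) (simp add: anti[symmetric])
  then have "?S = - ?S"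
    by (simp add: sum_negf)
  then have "?S = 0"
    by (simp add: eq_neg_iff_add_eq_0 flip: scaleR_2)
  ultimately show ?thesis
    by simp
qed

section \<open>Diameters\<close>

lemma finite_pair_distances:
  "finite {norm (Z i - Z j :: real ^ 3) | i j :: nat. 1 \<le> i \<and> i < j \<and> j \<le> s}"
  by (rule finite_subset[of _ "(\<lambda>(i, j). norm (Z i - Z j)) ` ({..s} \<times> {..s})"]) auto

lemma max_distance_nonneg:
  assumes "s \<ge> 2"
  shows "0 \<le> max_distance s Z"
proof -
  have "norm (Z 1 - Z 2) \<le> max_distance s Z"
    unfolding max_distance_def using assms by (intro Max_ge finite_pair_distances) force
  then show ?thesis
    using norm_ge_zero order_trans by blast
qed

lemma norm_diff_le_max_distance:
  assumes "s \<ge> 2" "i \<in> {1..s}" "j \<in> {1..s}"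
  shows "norm (Z i - Z j) \<le> max_distance s Z"
proof -
  have lt: "norm (Z i - Z j) \<le> max_distance s Z" if "i < j" "i \<in> {1..s}" "j \<in> {1..s}" for i j
    unfolding max_distance_def using that by (intro Max_ge finite_pair_distances) auto
  consider "i < j" | "i = j" | "j < i" by linarith
  then show ?thesis
  proof cases
    case 1
    with lt assms show ?thesis by blast
  next
    case 2
    with assms show ?thesis by (simp add: max_distance_nonneg)
  next
    case 3
    with lt[of j i] assms show ?thesis by (simp add: norm_minus_commute)
  qed
qed

lemma max_distance_le:
  assumes "s \<ge> 2" "\<And>i j. i \<in> {1..s} \<Longrightarrow> j \<in> {1..s} \<Longrightarrow> norm (Z i - Z j) \<le> B"
  shows "max_distance s Z \<le> B"
proof -
  have "norm (Z 1 - Z 2) \<in> {norm (Z i - Z j) | i j. 1 \<le> i \<and> i < j \<and> j \<le> s}"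
    using assms(1) by force
  then have "{norm (Z i - Z j) | i j. 1 \<le> i \<and> i < j \<and> j \<le> s} \<noteq> {}"
    by blast
  then show ?thesis
    unfolding max_distance_def using assms(2) by (subst Max_le_iff[OF finite_pair_distances]) auto
qed

text \<open>The deviation from the mean is the average of the differences
  \<open>z i - z j\<close>.\<close>

lemma norm_diff_mean_le:
  fixes z :: "'i \<Rightarrow> 'a::real_normed_vector"
  assumes "finite I" "i \<in> I" "\<And>j. j \<in> I \<Longrightarrow> norm (z i - z j) \<le> D"
  shows "norm (z i - sum z I /\<^sub>R real (card I)) \<le> D"
proof -
  have card: "real (card I) > 0"
    using assms by (auto simp: card_gt_0_iff)
  then have "real (card I) *\<^sub>R (z i - sum z I /\<^sub>R real (card I)) = (\<Sum>j\<in>I. z i - z j)"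
    by (simp add: sum_subtractf scaleR_right_diff_distrib sum_constant_scaleR)
  then have "real (card I) * norm (z i - sum z I /\<^sub>R real (card I)) = norm (\<Sum>j\<in>I. z i - z j)"
    using card by (metis abs_of_pos norm_scaleR)
  also have "\<dots> \<le> real (card I) * D"
    using sum_norm_le[of I "\<lambda>j. z i - z j" "\<lambda>_. D"] assms by simp
  finally show ?thesis
    using card by simp
qed

theorem theorem5:
  fixes s :: nat and h :: real and f :: "real \<Rightarrow> real"
    and X V :: "nat \<Rightarrow> nat \<Rightarrow> real ^ 3"
    and M\<^sub>x M\<^sub>v :: real
  assumes "s \<ge> 2" and "h > 0"
    and "\<And>y. y \<ge> 0 \<Longrightarrow> f y \<ge> 0"
    and "antimono_on {0..} f"
    and "\<And>y. y \<ge> 0 \<Longrightarrow> f y < 1 / real s"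
    and "\<And>i n. i \<in> {1..s} \<Longrightarrow> X i (Suc n) = X i n + h *\<^sub>R V i n"
    and "\<And>i n. i \<in> {1..s} \<Longrightarrow>
           V i (Suc n) = V i n + (\<Sum>j\<in>{1..s} - {i}. f (norm (X i n - X j n)) *\<^sub>R (V j n - V i n))"
    and "M\<^sub>x = max_distance s (\<lambda>i. X i 0)"
    and "M\<^sub>v = max_distance s (\<lambda>i. V i 0)"
    and "ennreal M\<^sub>v < ennreal (real s / (3 * h)) * (\<integral>\<^sup>+y\<in>{M\<^sub>x..}. ennreal (f y) \<partial>lborel)"
  shows "(\<exists>v. \<forall>i\<in>{1..s}. (\<lambda>n. V i n) \<longlonglongrightarrow> v) \<and>
         (\<exists>R\<ge>0. \<forall>i\<in>{1..s}. \<forall>j\<in>{1..s}. \<forall>n. norm (X i n - X j n) \<le> R)"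
proof -
  note s = \<open>s \<ge> 2\<close> and h = \<open>h > 0\<close> and nonneg = assms(3) and anti = assms(4) and less = assms(5)
    and X = assms(6) and V = assms(7) and lt = assms(10)
  define D where "D n = max_distance s (\<lambda>i. X i n)" for n
  define E where "E n = max_distance s (\<lambda>i. V i n)" for n
  have D0: "D n \<ge> 0" and E0: "E n \<ge> 0" for n
    using s by (simp_all add: D_def E_def max_distance_nonneg)
  have D_ge: "norm (X i n - X j n) \<le> D n" and E_ge: "norm (V i n - V j n) \<le> E n"
    if "i \<in> {1..s}" "j \<in> {1..s}" for i j n
    using norm_diff_le_max_distance[OF s that, of "\<lambda>i. X i n"]
      norm_diff_le_max_distance[OF s that, of "\<lambda>i. V i n"]
    by (simp_all add: D_def E_def)
  have D_Suc: "D (Suc n) \<le> D n + h * E n" for n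
    unfolding D_def[of "Suc n"]
  proof (rule max_distance_le[OF s])
    fix i j assume ij: "i \<in> {1..s}" "j \<in> {1..s}"
    have "X i (Suc n) - X j (Suc n) = (X i n - X j n) + h *\<^sub>R (V i n - V j n)"
      using ij by (simp add: X algebra_simps)
    also have "norm \<dots> \<le> norm (X i n - X j n) + h * norm (V i n - V j n)"
      using norm_triangle_ineq[of "X i n - X j n" "h *\<^sub>R (V i n - V j n)"] h by simp
    also have "\<dots> \<le> D n + h * E n"
      using D_ge[OF ij] E_ge[OF ij] h by (intro add_mono mult_left_mono) auto
    finally show "norm (X i (Suc n) - X j (Suc n)) \<le> D n + h * E n" .
  qed
  have E_Suc: "E (Suc n) \<le> (1 - real s * f (D n)) * E n" for n
    unfolding E_def[of "Suc n"]
  proof (rule max_distance_le[OF s])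
    fix i j assume ij: "i \<in> {1..s}" "j \<in> {1..s}"
    have lo: "f (D n) \<le> f (norm (X k n - X l n))" if "k \<in> {1..s}" "l \<in> {1..s}" for k l
      using anti D_ge[OF that, of n] D0[of n] by (auto simp: monotone_on_def)
    show "norm (V i (Suc n) - V j (Suc n)) \<le> (1 - real s * f (D n)) * E n"
      unfolding V[OF ij(1)] V[OF ij(2)]
      using norm_consensus_step_diff_le[of "{1..s}" i j "f (D n)" "\<lambda>k l. f (norm (X k n - X l n))"
          "\<lambda>k. V k n" "E n"] ij lo less E_ge by simp
  qed
  have "ennreal (E 0) < ennreal (real s / (3 * h)) * (\<integral>\<^sup>+y\<in>{D 0..}. ennreal (f y) \<partial>lborel)"
    using lt by (simp add: assms(8,9) D_def E_def)
  \<comment> \<open>Enlarges the constant to the shape \<open>\<sigma> / h\<close> of the recurrence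
    lemma, with \<open>real s\<close> for \<sigma>.\<close>
  also have "\<dots> \<le> ennreal (real s / h) * (\<integral>\<^sup>+y\<in>{D 0..}. ennreal (f y) \<partial>lborel)"
    using h by (intro mult_right_mono ennreal_leI) (auto simp: field_simps)
  finally have "\<exists>r\<ge>0. f r > 0 \<and> (\<forall>n. D n \<le> r)"
    using s
    by (intro bounded_of_coupled_recurrence[where d = D and e = E and h = h and \<sigma> = "real s"]
        anti nonneg h D0 E0 D_Suc E_Suc) auto
  then obtain r where r: "r \<ge> 0" "f r > 0" "\<And>n. D n \<le> r"
    by blast

  \<comment> \<open>A contraction factor valid for all times: \<open>D n \<le> r\<close> gives
    \<open>f r \<le> f (D n)\<close>. It is below 1 because \<open>f r > 0\<close>, and nonnegative
    because \<open>f r < 1 / real s\<close>.\<close>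
  define q where "q = 1 - real s * f r"
  have q: "0 \<le> q" "q < 1"
    using less[OF r(1)] r(2) s by (simp_all add: q_def field_simps)
  have E_le: "E n \<le> q ^ n * E 0" for n
  proof (induction n)
    case (Suc n)
    have "f r \<le> f (D n)"
      using anti r D0[of n] by (auto simp: monotone_on_def)
    then have "E (Suc n) \<le> q * E n"
      using E_Suc[of n] E0[of n] unfolding q_def
      by (smt (verit, best) mult_left_mono mult_right_mono of_nat_0_le_iff)
    also have "\<dots> \<le> q * (q ^ n * E 0)"
      using Suc.IH q by (intro mult_left_mono) auto
    finally show ?case by (simp add: mult.assoc)
  qed simp

  \<comment> \<open>The weights depend only on the distance, so the exchanges between
    \<open>i\<close> and \<open>j\<close> cancel in pairs.\<close>
  have mean: "(\<Sum>i\<in>{1..s}. V i n) = (\<Sum>i\<in>{1..s}. V i 0)" for n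
  proof (induction n)
    case (Suc n)
    have "(\<Sum>i\<in>{1..s}. \<Sum>j\<in>{1..s} - {i}. f (norm (X i n - X j n)) *\<^sub>R (V j n - V i n)) = 0"
      by (rule sum_antisymmetric_eq_0)
        (simp_all add: norm_minus_commute flip: scaleR_minus_right)
    then have "(\<Sum>i\<in>{1..s}. V i (Suc n)) = (\<Sum>i\<in>{1..s}. V i n)"
      by (simp add: V sum.distrib)
    with Suc.IH show ?case by simp
  qed simp
  \<comment> \<open>By conservation this is the mean velocity at every time, so each
    \<open>V i n\<close> stays within \<open>E n\<close> of it.\<close>
  define v where "v = (\<Sum>i\<in>{1..s}. V i 0) /\<^sub>R real s"
  have "(\<lambda>n. V i n) \<longlonglongrightarrow> v" if i: "i \<in> {1..s}" for i
  proof -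
    have "norm (V i n - v) \<le> q ^ n * E 0" for n
      using norm_diff_mean_le[of "{1..s}" i "\<lambda>i. V i n" "E n"] i E_ge[OF i] E_le[of n]
      unfolding v_def mean[of n] by simp
    moreover have "(\<lambda>n. q ^ n * E 0) \<longlonglongrightarrow> 0"
      using q by (intro tendsto_mult_left_zero LIMSEQ_power_zero) auto
    ultimately have "(\<lambda>n. V i n - v) \<longlonglongrightarrow> 0"
      by (intro Lim_null_comparison[of "\<lambda>n. V i n - v"]) auto
    then show ?thesis
      using LIM_zero_iff by blast
  qed
  moreover have "norm (X i n - X j n) \<le> r" if "i \<in> {1..s}" "j \<in> {1..s}" for i j n
    using D_ge[OF that, of n] r(3)[of n] by linarith
  ultimately show ?thesis
    using r(1) by blast
qed

end
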